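(* Let $k\ge 9$ be an integer and $r\in\mathbb{Z}_{2k}$. If $T_3(k,r)$ is connected, then it is isomorphic to either a prism or a M\"obius ladder.
   Context: $T_3(k,r)$ is the graph with vertex set $\{u_i,v_i,w_i: i\in\mathbb{Z}_{2k}\}$ and edges $u_iu_{i+k}$, $v_iv_{i+k}$, $w_iw_{i+k}$, $u_iv_i$, $u_iw_i$, $v_iw_{i+r}$ ($i\in\mathbb{Z}_{2k}$). A prism of order $2n$ is $C_n\square K_2$; a M\"obius ladder of order $2n$ is a $2n$-cycle together with all edges joining antipodal vertices. *)

theory Defs
  imports "Graph_Theory.Graph_Theory"
begin

text \<open>An undirected graph is represented, as usual in Graph_Theory, by the symmetric digraph that has
  both arcs \<open>(x, y)\<close> and \<open>(y, x)\<close> for every edge \<open>{x, y}\<close>.\<close>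

definition ugraph :: "'a set \<Rightarrow> 'a set set \<Rightarrow> 'a pair_pre_digraph" where
  "ugraph V E = \<lparr>pverts = V, parcs = {(x, y). {x, y} \<in> E}\<rparr>"

definition cycle_edges :: "nat \<Rightarrow> nat set set" where
  "cycle_edges n = {{i, (i + 1) mod n} | i. i < n}"

text \<open>Meaningful for \<open>n \<ge> 3\<close> only.\<close>

definition cycle_graph :: "nat \<Rightarrow> nat pair_pre_digraph" where
  "cycle_graph n = ugraph {0..<n} (cycle_edges n)"

definition complete_graph :: "nat \<Rightarrow> nat pair_pre_digraph" where
  "complete_graph n = ugraph {0..<n} {{i, j} | i j. i < n \<and> j < n \<and> i \<noteq> j}"

definition cartesian_product ::
  "'a pair_pre_digraph \<Rightarrow> 'b pair_pre_digraph \<Rightarrow> ('a \<times> 'b) pair_pre_digraph" where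
  "cartesian_product G H = \<lparr>
     pverts = pverts G \<times> pverts H,
     parcs = {((a, b), (a', b')).
       (a = a' \<and> a \<in> pverts G \<and> (b, b') \<in> parcs H) \<or>
       ((a, a') \<in> parcs G \<and> b = b' \<and> b \<in> pverts H)}\<rparr>"

text \<open>The prism and the Moebius ladder of order \<open>2 * n\<close>.\<close>

definition prism :: "nat \<Rightarrow> (nat \<times> nat) pair_pre_digraph" where
  "prism n = cartesian_product (cycle_graph n) (complete_graph 2)"

definition moebius_ladder :: "nat \<Rightarrow> nat pair_pre_digraph" where
  "moebius_ladder n =
     ugraph {0..<2 * n} (cycle_edges (2 * n) \<union> {{i, (i + n) mod (2 * n)} | i. i < 2 * n})"

text \<open>The ring of integers modulo \<open>2 * k\<close> is represented by the residues \<open>{0..<2 * k}\<close>.\<close>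

datatype t3_vertex = U nat | V nat | W nat

definition T3 :: "nat \<Rightarrow> nat \<Rightarrow> t3_vertex pair_pre_digraph" where
  "T3 k r = ugraph
     (U ` {0..<2 * k} \<union> V ` {0..<2 * k} \<union> W ` {0..<2 * k})
     (\<Union>i \<in> {0..<2 * k}.
        {{U i, U ((i + k) mod (2 * k))},
         {V i, V ((i + k) mod (2 * k))},
         {W i, W ((i + k) mod (2 * k))},
         {U i, V i},
         {U i, W i},
         {V i, W ((i + r) mod (2 * k))}})"

end

theory Submission
  imports Defs "HOL-Number_Theory.Cong"
begin

text \<open>The edges other than the rungs, which shift the index by \<open>k\<close>, form a 2-factor traversed as
  \<open>U i, V i, W (i + r), U (i + r), \<dots>\<close>. Since the residue of the index modulo \<open>gcd r k\<close> is constant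
  along every edge, connectedness forces \<open>r\<close> and \<open>k\<close> to be coprime. If \<open>r\<close> is odd, it generates
  the integers modulo \<open>2 * k\<close>, the 2-factor is one cycle of length \<open>6 * k\<close>, and since \<open>k * r\<close> is
  congruent to \<open>k\<close> the rungs join antipodal vertices. If \<open>r\<close> is even, then \<open>k\<close> is odd, the 2-factor
  consists of two cycles of length \<open>3 * k\<close>, and adding \<open>k\<close> to the index exchanges them.\<close>

section \<open>Isomorphisms between graphs given by edge sets\<close>

lemma ugraph_image_iso:
  assumes inj: "inj_on f A" and E: "E \<subseteq> {{x, y} | x y. x \<in> A \<and> y \<in> A}"
  shows "digraph_iso (with_proj (ugraph A E)) (with_proj (ugraph (f ` A) ((`) f ` E)))"
proof -
  let ?h = "\<lparr>iso_verts = f, iso_arcs = map_prod f f, iso_head = snd, iso_tail = fst\<rparr>"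
  have sub: "parcs (ugraph A E) \<subseteq> A \<times> A"
    using E by (fastforce simp: ugraph_def doubleton_eq_iff)
  have "wf_digraph (with_proj (ugraph A E))"
    using sub by unfold_locales (auto simp: ugraph_def)
  moreover have "inj_on (map_prod f f) (parcs (ugraph A E))"
    using map_prod_inj_on[OF inj inj] sub by (rule inj_on_subset)
  ultimately have iso: "pre_digraph.digraph_isomorphism (with_proj (ugraph A E)) ?h"
    using inj by (auto simp: pre_digraph.digraph_isomorphism_def ugraph_def)
  \<comment> \<open>An unordered edge determines its image arc only up to orientation, so both arcs
    of the preimage edge are offered.\<close>
  have "(u, v) \<in> map_prod f f ` parcs (ugraph A E)" if uv: "{u, v} \<in> (`) f ` E" for u v
  proof -
    obtain x y where xy: "{x, y} \<in> E" "{u, v} = f ` {x, y}"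
      using uv E by blast
    then have "(u, v) = map_prod f f (x, y) \<or> (u, v) = map_prod f f (y, x)"
      by (auto simp: doubleton_eq_iff)
    moreover have "(x, y) \<in> parcs (ugraph A E)" "(y, x) \<in> parcs (ugraph A E)"
      using xy(1) by (simp_all add: ugraph_def insert_commute)
    ultimately show ?thesis by (metis imageI)
  qed
  moreover have "{f x, f y} \<in> (`) f ` E" if "{x, y} \<in> E" for x y
    using imageI[OF that, of "(`) f"] by simp
  ultimately have "map_prod f f ` parcs (ugraph A E) = {(u, v). {u, v} \<in> (`) f ` E}"
    by (auto simp: ugraph_def)
  then have "with_proj (ugraph (f ` A) ((`) f ` E)) = app_iso ?h (with_proj (ugraph A E))"
    by (simp add: with_proj_def app_iso_def ugraph_def)
  with iso show ?thesis
    unfolding digraph_iso_def by blast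
qed

text \<open>The natural bijection \<open>f\<close> runs from positions in the standard graph to
  vertices of \<open>T3 k r\<close>, whereas the isomorphism wanted starts at \<open>T3 k r\<close>.
  Hence the previous lemma is applied to the inverse of \<open>f\<close>.\<close>

lemma ugraph_isoI:
  assumes bij: "bij_betw f A A'" and E: "E \<subseteq> {{x, y} | x y. x \<in> A \<and> y \<in> A}"
    and E': "E' = (`) f ` E"
  shows "digraph_iso (with_proj (ugraph A' E')) (with_proj (ugraph A E))"
proof -
  let ?g = "inv_into A f"
  have bij': "bij_betw ?g A' A"
    using bij by (rule bij_betw_inv_into)
  have gf: "?g (f x) = x" if "x \<in> A" for x
    using bij that by (rule bij_betw_inv_into_left)
  have fV: "f x \<in> A'" if "x \<in> A" for x
    using bij that by (rule bij_betwE[rule_format])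
  have "?g ` f ` e = e" if e: "e \<in> E" for e
  proof -
    obtain x y where "e = {x, y}" "x \<in> A" "y \<in> A" using E e by blast
    then show ?thesis by (simp add: gf)
  qed
  then have "(`) ?g ` E' = E"
    by (simp add: E' image_image)
  moreover have "E' \<subseteq> {{x, y} | x y. x \<in> A' \<and> y \<in> A'}"
  proof
    fix e assume "e \<in> E'"
    then obtain x y where "e = f ` {x, y}" "x \<in> A" "y \<in> A" using E E' by blast
    then show "e \<in> {{x, y} | x y. x \<in> A' \<and> y \<in> A'}" using fV by auto
  qed
  ultimately show ?thesis
    using ugraph_image_iso[OF bij_betw_imp_inj_on[OF bij'], of E']
    by (simp add: bij_betw_imp_surj_on[OF bij'])
qed

text \<open>Yields injectivity of a parametrization of the vertices by counting, instead of an
  argument that the walk never repeats a vertex.\<close>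

lemma bij_betw_if_surj_card:
  assumes "finite A" "card A = card B" "f ` A = B"
  shows "bij_betw f A B"
  using assms by (simp add: bij_betw_def eq_card_imp_inj_on)

lemma connected_invariant:
  assumes "Digraph_Component.connected (with_proj G)"
    and step: "\<And>x y. (x, y) \<in> parcs G \<Longrightarrow> f x = f y"
    and "x \<in> pverts G" "y \<in> pverts G"
  shows "f x = f y"
proof -
  have "x \<rightarrow>\<^sup>*\<^bsub>mk_symmetric (with_proj G)\<^esub> y"
    using assms by (auto simp: Digraph_Component.connected_def strongly_connected_def)
  then have "(x, y) \<in> (parcs (mk_symmetric (with_proj G)))\<^sup>*"
    by (simp add: reachable_def rtrancl_on_rtranclI)
  then show ?thesis
    by (induction rule: rtrancl_induct) (auto simp: parcs_mk_symmetric dest: step)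
qed

text \<open>The position \<open>j\<close> along the 2-factor, started at index \<open>c\<close>.\<close>

definition T3_walk :: "nat \<Rightarrow> nat \<Rightarrow> nat \<Rightarrow> nat \<Rightarrow> t3_vertex" where
  "T3_walk k r j c =
     (if j mod 3 = 0 then U ((j div 3 * r + c) mod (2 * k))
      else if j mod 3 = 1 then V ((j div 3 * r + c) mod (2 * k))
      else W ((Suc (j div 3) * r + c) mod (2 * k)))"

section \<open>Arithmetic of the walk along the 2-factor\<close>

lemma T3_walk_simps:
  "T3_walk k r (3 * a) c = U ((a * r + c) mod (2 * k))"
  "T3_walk k r (Suc (3 * a)) c = V ((a * r + c) mod (2 * k))"
  "T3_walk k r (Suc (Suc (3 * a))) c = W ((Suc a * r + c) mod (2 * k))"
  "T3_walk k r (Suc (Suc (Suc (3 * a)))) c = U ((Suc a * r + c) mod (2 * k))"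
proof -
  have "Suc (3 * a) mod 3 = 1" "Suc (Suc (3 * a)) mod 3 = 2" "Suc (Suc (3 * a)) div 3 = a"
    "Suc (3 * a) div 3 = a" "Suc (Suc (Suc (3 * a))) mod 3 = 0"
    "Suc (Suc (Suc (3 * a))) div 3 = Suc a"
    by presburger+
  then show "T3_walk k r (3 * a) c = U ((a * r + c) mod (2 * k))"
    "T3_walk k r (Suc (3 * a)) c = V ((a * r + c) mod (2 * k))"
    "T3_walk k r (Suc (Suc (3 * a))) c = W ((Suc a * r + c) mod (2 * k))"
    "T3_walk k r (Suc (Suc (Suc (3 * a)))) c = U ((Suc a * r + c) mod (2 * k))"
    by (simp_all add: T3_walk_def)
qed

text \<open>Three steps pass one vertex of each kind and raise the index by
  \<open>r\<close>.\<close>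

lemma T3_walk_shift: "T3_walk k r (j + 3 * m) c = T3_walk k r j (m * r + c)"
  by (simp add: T3_walk_def algebra_simps)

lemma T3_walk_cong:
  assumes "c mod (2 * k) = c' mod (2 * k)"
  shows "T3_walk k r j c = T3_walk k r j c'"
proof -
  have "(n + c) mod (2 * k) = (n + c') mod (2 * k)" for n
    using assms by (rule mod_add_cong[OF refl])
  then show ?thesis by (simp only: T3_walk_def)
qed

text \<open>The walk closes up after \<open>3 * m\<close> steps, since by then the index has grown
  by a multiple of \<open>2 * k\<close>.\<close>

lemma T3_walk_mod:
  assumes "2 * k dvd m * r" "j < 3 * m"
  shows "T3_walk k r (Suc j mod (3 * m)) c = T3_walk k r (Suc j) c"
proof (cases "Suc j = 3 * m")
  case True
  then have "T3_walk k r (Suc j) c = T3_walk k r 0 (m * r + c)"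
    using T3_walk_shift[of k r 0 m c] by simp
  also have "\<dots> = T3_walk k r 0 c"
    using assms(1) by (intro T3_walk_cong) (metis add_0 mod_add_left_eq dvd_imp_mod_0)
  finally show ?thesis using True by simp
next
  case False
  then show ?thesis using assms(2) by simp
qed

lemma mod_3_cases:
  fixes j m :: nat
  assumes "j < 3 * m"
  obtains a where "a < m" "j = 3 * a" | a where "a < m" "j = Suc (3 * a)"
    | a where "a < m" "j = Suc (Suc (3 * a))"
proof -
  have "j div 3 < m" "j = 3 * (j div 3) \<or> j = Suc (3 * (j div 3)) \<or> j = Suc (Suc (3 * (j div 3)))"
    using assms by presburger+
  then show ?thesis using that by blast
qed

section \<open>Covering the graph by closed walks\<close>

text \<open>Common setting for both parities of \<open>r\<close>: \<open>C\<close> holds one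
  starting index per cycle of the 2-factor and \<open>3 * m\<close> is the length of each. The
  instances are \<open>m = 2 * k\<close>, \<open>C = {0}\<close> and \<open>m = k\<close>,
  \<open>C = {0, k}\<close>.\<close>

locale T3_cover =
  fixes k r m :: nat and C :: "nat set"
  assumes k: "k > 0" and period: "2 * k dvd m * r"
    and cover: "\<And>i. i < 2 * k \<Longrightarrow> \<exists>a<m. \<exists>c\<in>C. i = (a * r + c) mod (2 * k)"
begin

abbreviation walk :: "nat \<Rightarrow> nat \<Rightarrow> t3_vertex" where
  "walk \<equiv> T3_walk k r"

text \<open>On the walk a \<open>W\<close> carries the index of the next \<open>U\<close>, so
  \<open>W i\<close> is located by covering i - r.\<close>

lemma cover_Suc:
  assumes "i < 2 * k"
  obtains a c where "a < m" "c \<in> C" "i = (Suc a * r + c) mod (2 * k)"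
proof -
  \<comment> \<open>The residue of i - r, written so that subtraction on naturals never
    truncates.\<close>
  define i' where "i' = (i + (2 * k - r mod (2 * k))) mod (2 * k)"
  have "i' < 2 * k" using k by (simp add: i'_def)
  then obtain a c where ac: "a < m" "c \<in> C" "i' = (a * r + c) mod (2 * k)" using cover by blast
  have "(Suc a * r + c) mod (2 * k) = (r mod (2 * k) + i') mod (2 * k)"
    by (simp only: ac(3) mod_add_eq mult_Suc add.assoc)
  also have "\<dots> = (i + (r mod (2 * k) + (2 * k - r mod (2 * k)))) mod (2 * k)"
    by (simp only: i'_def mod_add_right_eq add.left_commute)
  also have "r mod (2 * k) + (2 * k - r mod (2 * k)) = 2 * k"
    using k by (intro le_add_diff_inverse less_imp_le mod_less_divisor) simp
  finally have "(Suc a * r + c) mod (2 * k) = i" using assms by simp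
  with ac that show ?thesis by metis
qed

lemma T3_verts_eq: "pverts (T3 k r) = (\<lambda>(j, c). walk j c) ` ({..<3 * m} \<times> C)"
proof
  show "pverts (T3 k r) \<subseteq> (\<lambda>(j, c). walk j c) ` ({..<3 * m} \<times> C)"
  proof
    fix x assume "x \<in> pverts (T3 k r)"
    then consider i where "i < 2 * k" "x = U i" | i where "i < 2 * k" "x = V i"
      | i where "i < 2 * k" "x = W i"
      by (auto simp: T3_def ugraph_def)
    then have "\<exists>j<3 * m. \<exists>c\<in>C. x = walk j c"
    proof cases
      case 1
      then obtain a c where "a < m" "c \<in> C" "x = walk (3 * a) c"
        using cover by (metis T3_walk_simps(1))
      moreover have "3 * a < 3 * m" using \<open>a < m\<close> by simp
      ultimately show ?thesis by blast
    next
      case 2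
      then obtain a c where "a < m" "c \<in> C" "x = walk (Suc (3 * a)) c"
        using cover by (metis T3_walk_simps(2))
      moreover have "Suc (3 * a) < 3 * m" using \<open>a < m\<close> by simp
      ultimately show ?thesis by blast
    next
      case 3
      then obtain a c where "a < m" "c \<in> C" "x = walk (Suc (Suc (3 * a))) c"
        using cover_Suc by (metis T3_walk_simps(3))
      moreover have "Suc (Suc (3 * a)) < 3 * m" using \<open>a < m\<close> by simp
      ultimately show ?thesis by blast
    qed
    then show "x \<in> (\<lambda>(j, c). walk j c) ` ({..<3 * m} \<times> C)" by auto
  qed
  show "(\<lambda>(j, c). walk j c) ` ({..<3 * m} \<times> C) \<subseteq> pverts (T3 k r)"
    using k by (auto simp: T3_def ugraph_def T3_walk_def)
qed

text \<open>The first kind of edge is a step of the walk, the second a rung. The far end of a rung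
  is given by the start \<open>c + k\<close>, which may lie outside \<open>C\<close>.\<close>

definition walk_edges :: "t3_vertex set set" where
  "walk_edges = (\<Union>j<3 * m. \<Union>c\<in>C. {{walk j c, walk (Suc j) c}, {walk j c, walk j (c + k)}})"

lemma walk_edgesI:
  assumes "j < 3 * m" "c \<in> C"
  shows "{walk j c, walk (Suc j) c} \<in> walk_edges" "{walk j c, walk j (c + k)} \<in> walk_edges"
  using assms by (auto simp: walk_edges_def)

lemma T3_eq: "T3 k r = ugraph (pverts (T3 k r)) walk_edges"
proof -
  let ?N = "2 * k"
  let ?F = "\<lambda>i. {{U i, U ((i + k) mod ?N)}, {V i, V ((i + k) mod ?N)},
    {W i, W ((i + k) mod ?N)}, {U i, V i}, {U i, W i}, {V i, W ((i + r) mod ?N)}}"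
  let ?E = "\<Union>i\<in>{0..<?N}. ?F i"
  \<comment> \<open>Edges met at positions \<open>3 * a\<close> and \<open>Suc (3 * a)\<close>.
    Those met at a \<open>W\<close> are treated apart, as they need
    \<open>cover_Suc\<close>.\<close>
  have UV: "?F i \<inter> {{U i, U ((i + k) mod ?N)}, {V i, V ((i + k) mod ?N)}, {U i, V i},
      {V i, W ((i + r) mod ?N)}} \<subseteq> walk_edges" if i: "i < ?N" for i
  proof -
    obtain a c where ac: "a < m" "c \<in> C" "i = (a * r + c) mod ?N" using cover[OF i] by blast
    then have "3 * a < 3 * m" "Suc (3 * a) < 3 * m" by simp_all
    from this[THEN walk_edgesI(1), OF ac(2)] this[THEN walk_edgesI(2), OF ac(2)]
    show ?thesis
      by (simp add: T3_walk_simps ac(3) mod_simps add.assoc add.commute add.left_commute)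
  qed
  have W: "{{W i, W ((i + k) mod ?N)}, {U i, W i}} \<subseteq> walk_edges" if i: "i < ?N" for i
  proof -
    obtain a c where ac: "a < m" "c \<in> C" "i = (Suc a * r + c) mod ?N" using cover_Suc[OF i] by blast
    then have "Suc (Suc (3 * a)) < 3 * m" by simp
    from this[THEN walk_edgesI(1), OF ac(2)] this[THEN walk_edgesI(2), OF ac(2)]
    show ?thesis
      by (simp add: T3_walk_simps ac(3) mod_simps
        add.assoc add.commute add.left_commute insert_commute)
  qed
  have sub: "?E \<subseteq> walk_edges"
    using UV W by fastforce
  have walk: "{walk j c, walk (Suc j) c} \<in> ?E \<and> {walk j c, walk j (c + k)} \<in> ?E"
    if "j < 3 * m" "c \<in> C" for j c
    using that(1)
  proof (cases rule: mod_3_cases)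
    case (1 a)
    have "?F ((a * r + c) mod ?N) \<subseteq> ?E" using k by (intro UN_upper) simp
    then show ?thesis by (simp add: 1 T3_walk_simps mod_simps add.assoc add.commute add.left_commute)
  next
    case (2 a)
    have "?F ((a * r + c) mod ?N) \<subseteq> ?E" using k by (intro UN_upper) simp
    then show ?thesis by (simp add: 2 T3_walk_simps mod_simps add.assoc add.commute add.left_commute)
  next
    case (3 a)
    have "?F ((Suc a * r + c) mod ?N) \<subseteq> ?E" using k by (intro UN_upper) simp
    then show ?thesis by (simp add: 3 T3_walk_simps mod_simps
        add.assoc add.commute add.left_commute insert_commute)
  qed
  have "walk_edges \<subseteq> ?E"
    unfolding walk_edges_def
    by (intro UN_least insert_subsetI empty_subsetI; simp only: walk lessThan_iff)
  with sub have "?E = walk_edges" by (rule equalityI)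
  then show ?thesis by (simp add: T3_def ugraph_def)
qed

end

section \<open>Order and connectivity\<close>

lemma card_T3: "card (pverts (T3 k r)) = 6 * k"
proof -
  have "card (pverts (T3 k r)) =
      card (U ` {0..<2 * k}) + card (V ` {0..<2 * k}) + card (W ` {0..<2 * k})"
  proof -
    have "U ` A \<inter> V ` A = {}" "(U ` A \<union> V ` A) \<inter> W ` A = {}" for A by auto
    then show ?thesis by (simp add: T3_def ugraph_def card_Un_disjoint)
  qed
  then show ?thesis by (simp add: card_image inj_on_def)
qed

lemma T3_connected_coprime:
  assumes "k > 0" and conn: "Digraph_Component.connected (with_proj (T3 k r))"
  shows "coprime r k"
proof -
  define g where "g = gcd r k"
  define f where "f x = (case x of U i \<Rightarrow> i mod g | V i \<Rightarrow> i mod g | W i \<Rightarrow> i mod g)" for x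
  have g: "g dvd r" "g dvd k" by (simp_all add: g_def)
  \<comment> \<open>Reducing modulo \<open>2 * k\<close> keeps residues modulo \<open>g\<close>
    because \<open>g\<close> divides \<open>k\<close>, and shifts by \<open>k\<close> or
    \<open>r\<close> vanish modulo \<open>g\<close>.\<close>
  have mods: "(i + k) mod (2 * k) mod g = i mod g" "(i + r) mod (2 * k) mod g = i mod g" for i
    using g by (simp_all add: mod_mod_cancel) (metis add.right_neutral dvd_imp_mod_0 mod_add_right_eq)+
  have "f (U 0) = f (U 1)"
  proof (rule connected_invariant[OF conn])
    show "f x = f y" if "(x, y) \<in> parcs (T3 k r)" for x y
      using that by (auto simp: T3_def ugraph_def doubleton_eq_iff f_def mods)
    show "U 0 \<in> pverts (T3 k r)" "U 1 \<in> pverts (T3 k r)"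
      using \<open>k > 0\<close> by (auto simp: T3_def ugraph_def)
  qed
  then have "1 mod g = 0" by (simp add: f_def)
  then show ?thesis by (simp add: g_def coprime_iff_gcd_eq_1 mod_eq_0_iff_dvd)
qed

section \<open>The two isomorphism types\<close>

lemma (in T3_cover) T3_iso_moebius_ladder:
  assumes C: "C = {0}" and m: "m = 2 * k" and r: "odd r"
  shows "digraph_iso (with_proj (T3 k r)) (with_proj (moebius_ladder (3 * k)))"
proof -
  let ?f = "\<lambda>j. walk j 0"
  let ?R = "{{i, (i + 3 * k) mod (2 * (3 * k))} | i. i < 2 * (3 * k)}"
  have verts: "?f ` {0..<2 * (3 * k)} = pverts (T3 k r)"
    unfolding T3_verts_eq by (auto simp: C m)
  have "bij_betw ?f {0..<2 * (3 * k)} (pverts (T3 k r))"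
    using verts by (intro bij_betw_if_surj_card) (simp_all add: card_T3)
  moreover have "cycle_edges (2 * (3 * k)) \<union> ?R
      \<subseteq> {{x, y} | x y. x \<in> {0..<2 * (3 * k)} \<and> y \<in> {0..<2 * (3 * k)}}"
    using k by (fastforce simp: cycle_edges_def)
  moreover have "walk_edges = (`) ?f ` (cycle_edges (2 * (3 * k)) \<union> ?R)"
  proof -
    have cyc: "?f ((j + 1) mod (2 * (3 * k))) = ?f (Suc j)" if "j < 2 * (3 * k)" for j
      using T3_walk_mod[OF period, of j 0] that by (simp add: m)
    \<comment> \<open>For r = 2b + 1 the product is 2kb + k.\<close>
    have kr: "(k * r) mod (2 * k) = k"
      using r k by (elim oddE) (simp add: algebra_simps)
    have rung: "?f ((j + 3 * k) mod (2 * (3 * k))) = walk j k" if j: "j < 2 * (3 * k)" for j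
    proof -
      have "walk (j + 3 * k) 0 = walk j k"
        unfolding T3_walk_shift by (rule T3_walk_cong) (simp add: kr)
      \<comment> \<open>Reducing the position drops at most one full turn of \<open>6 * k\<close>
        steps, which is harmless by \<open>period\<close>.\<close>
      moreover have "?f ((j + 3 * k) mod (2 * (3 * k))) = walk (j + 3 * k) 0"
      proof (cases "j < 3 * k")
        case True
        then show ?thesis by simp
      next
        case False
        then have "(j + 3 * k) mod (2 * (3 * k)) = j - 3 * k" using j by (simp add: mod_if)
        moreover have "j + 3 * k = j - 3 * k + 3 * m" using False by (simp add: m)
        moreover have "walk (j - 3 * k + 3 * m) 0 = walk (j - 3 * k) 0"
          unfolding T3_walk_shift using period by (intro T3_walk_cong) simp
        ultimately show ?thesis by simp
      qed
      ultimately show ?thesis by simp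
    qed
    have "(`) ?f ` cycle_edges (2 * (3 * k)) = {{?f j, ?f (Suc j)} | j. j < 2 * (3 * k)}"
      unfolding cycle_edges_def using cyc by (auto simp: setcompr_eq_image image_image)
    moreover have "(`) ?f ` ?R = {{?f j, walk j k} | j. j < 2 * (3 * k)}"
      using rung by (auto simp: setcompr_eq_image image_image)
    ultimately show ?thesis
      unfolding image_Un walk_edges_def by (auto simp: C m)
  qed
  ultimately show ?thesis
    unfolding moebius_ladder_def by (subst T3_eq) (rule ugraph_isoI)
qed

text \<open>Brings the product, defined through arcs, into the edge-set form that
  \<open>ugraph_isoI\<close> expects: two copies of the cycle, then the rungs.\<close>

lemma prism_eq_ugraph:
  "prism n = ugraph ({0..<n} \<times> {0..<2})
     ({{(i, e), ((i + 1) mod n, e)} | i e. i < n \<and> e < 2} \<union> {{(i, 0), (i, 1)} | i. i < n})"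
proof -
  have "(\<exists>i j. {b, b'} = {i, j} \<and> i < 2 \<and> j < 2 \<and> i \<noteq> j) \<longleftrightarrow> {b, b'} = {0, 1}" for b b' :: nat
    by (auto simp: doubleton_eq_iff less_2_cases_iff)
  then show ?thesis
    unfolding prism_def cartesian_product_def cycle_graph_def complete_graph_def cycle_edges_def
      ugraph_def
    by (auto simp: doubleton_eq_iff)
qed

text \<open>The second coordinate \<open>e\<close> selects the closed walk started at
  \<open>e * k\<close>. Rungs keep the position and exchange the two walks.\<close>

lemma (in T3_cover) T3_iso_prism:
  assumes C: "C = {0, k}" and m: "m = k"
  shows "digraph_iso (with_proj (T3 k r)) (with_proj (prism (3 * k)))"
proof -
  let ?f = "\<lambda>(j, e). walk j (e * k)"
  let ?V = "{0..<3 * k} \<times> {0..<2::nat}"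
  let ?P = "{{(i, e), ((i + 1) mod (3 * k), e)} | i e. i < 3 * k \<and> e < (2::nat)}"
  let ?Q = "{{(i, 0), (i, 1::nat)} | i. i < 3 * k}"
  have C': "C = (\<lambda>e. e * k) ` {0..<2}"
    by (auto simp: C less_2_cases_iff image_iff)
  have verts: "?f ` ?V = pverts (T3 k r)"
    unfolding T3_verts_eq C' m by force
  have "bij_betw ?f ?V (pverts (T3 k r))"
    using verts by (intro bij_betw_if_surj_card) (simp_all add: card_T3)
  moreover have "?P \<union> ?Q \<subseteq> {{x, y} | x y. x \<in> ?V \<and> y \<in> ?V}"
    using k by fastforce
  moreover have "walk_edges = (`) ?f ` (?P \<union> ?Q)"
  proof -
    \<comment> \<open>Rungs seen from the walk started at \<open>k\<close> lead back to the one
      started at 0, so they repeat the rungs already listed.\<close>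
    have kk: "walk j (k + k) = walk j 0" for j
      by (rule T3_walk_cong) (simp flip: mult_2)
    have split: "{g j (e * k) | j e. j < 3 * k \<and> e < 2}
        = {g j 0 | j. j < 3 * k} \<union> {g j k | j. j < 3 * k}" for g :: "nat \<Rightarrow> nat \<Rightarrow> t3_vertex set"
      by (force simp: less_2_cases_iff)
    have eq: "?f ` {(j, e), ((j + 1) mod (3 * k), e)} = {walk j (e * k), walk (Suc j) (e * k)}"
      if "j < 3 * k" for j e
      using T3_walk_mod[OF period, of j "e * k"] that by (simp add: m)
    have "walk_edges = {{walk j 0, walk (Suc j) 0} | j. j < 3 * k}
        \<union> {{walk j k, walk (Suc j) k} | j. j < 3 * k} \<union> {{walk j 0, walk j k} | j. j < 3 * k}"
      unfolding walk_edges_def unfolding C m by (auto simp: kk insert_commute)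
    moreover have "(`) ?f ` ?P = {?f ` {(j, e), ((j + 1) mod (3 * k), e)} | j e. j < 3 * k \<and> e < 2}"
      by blast
    moreover have "\<dots> = {{walk j (e * k), walk (Suc j) (e * k)} | j e. j < 3 * k \<and> e < 2}"
      by (rule Collect_cong) (metis eq)
    moreover have "(`) ?f ` ?Q = {{walk j 0, walk j k} | j. j < 3 * k}"
      by (auto simp: setcompr_eq_image image_image)
    ultimately show ?thesis
      unfolding image_Un split[of "\<lambda>j c. {walk j c, walk (Suc j) c}"] by (simp only:)
  qed
  ultimately show ?thesis
    unfolding prism_eq_ugraph by (subst T3_eq) (rule ugraph_isoI)
qed

section \<open>Covering the residues and the case distinction\<close>

text \<open>Multiply \<open>i\<close> by an inverse of \<open>r\<close> modulo \<open>n\<close> and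
  reduce.\<close>

lemma coprime_multiple_cong:
  fixes r n i :: nat
  assumes "coprime r n" "n > 0"
  obtains a where "a < n" "[a * r = i] (mod n)"
proof -
  obtain x where x: "[r * x = 1] (mod n)"
    using cong_solve_coprime_nat[OF assms(1)] by auto
  have "[(x * i) mod n * r = (r * x) * i] (mod n)"
    by (simp add: cong_def mod_simps ac_simps)
  also have "[(r * x) * i = 1 * i] (mod n)"
    using x by (rule cong_scalar_right)
  finally have "[(x * i) mod n * r = i] (mod n)" by simp
  then show ?thesis using that assms(2) mod_less_divisor by blast
qed

theorem theorem6p1:
  fixes k r :: nat
  assumes "k \<ge> 9"
    and "r \<in> {0..<2 * k}"
    and "Digraph_Component.connected (with_proj (T3 k r))"
  shows "(\<exists>n\<ge>3. digraph_iso (with_proj (T3 k r)) (with_proj (prism n))) \<or>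
         (\<exists>n\<ge>3. digraph_iso (with_proj (T3 k r)) (with_proj (moebius_ladder n)))"
proof -
  have k: "k > 0" and k3: "3 * k \<ge> 3" using assms(1) by simp_all
  have cop: "coprime r k" using T3_connected_coprime[OF k assms(3)] .
  show ?thesis
  proof (cases "even r")
    case False
    then have cop2: "coprime r (2 * k)" using cop by simp
    interpret T3_cover k r "2 * k" "{0}"
    proof
      show "\<exists>a<2 * k. \<exists>c\<in>{0}. i = (a * r + c) mod (2 * k)" if "i < 2 * k" for i
        using coprime_multiple_cong[OF cop2, of i] k that by (auto simp: cong_def)
    qed (use k in simp_all)
    show ?thesis using T3_iso_moebius_ladder[OF refl refl False] k3 by blast
  next
    case True
    then have odd_k: "odd k" using cop by (auto simp: coprime_def)
    interpret T3_cover k r k "{0, k}"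
    proof
      show "2 * k dvd k * r" using True by (simp add: mult.commute)
      show "\<exists>a<k. \<exists>c\<in>{0, k}. i = (a * r + c) mod (2 * k)" if "i < 2 * k" for i
      proof -
        obtain a where a: "a < k" "[a * r = i] (mod k)" using coprime_multiple_cong[OF cop k] .
        \<comment> \<open>As \<open>k\<close> is odd, adding it flips the parity and keeps the
          residue modulo \<open>k\<close>. Since \<open>a * r\<close> is even, this choice makes the
          parity agree with that of \<open>i\<close>, and the congruences modulo \<open>k\<close>
          and 2 combine.\<close>
        define c where "c = (if even i then 0 else k)"
        have "[a * r + c = i] (mod k)" using a(2) by (simp add: c_def cong_def)
        moreover have "even (a * r + c) = even i" using True odd_k by (simp add: c_def)
        then have "[a * r + c = i] (mod 2)" by (simp add: cong_def mod2_eq_if)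
        ultimately have "[a * r + c = i] (mod (2 * k))"
          using odd_k by (intro coprime_cong_mult_nat) simp_all
        then have "i = (a * r + c) mod (2 * k)" using that by (simp add: cong_def)
        then show ?thesis using a(1) by (auto simp: c_def split: if_splits)
      qed
    qed (fact k)
    show ?thesis using T3_iso_prism[OF refl refl] k3 by blast
  qed
qed

end
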